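(* Let $G$ be an essential labelled graph and let $L=\mathcal{L}(G)$ be its (central regular) language. Then $L$ is the language of a chain-mixing subshift if and only if the linking graph $G/_\approx$ is connected and aperiodic.
   Context: Let $A$ be a finite alphabet. $A^{\mathbb Z}$ carries the metric $\rho(x,x)=0$ and, for $x\ne y$, $\rho(x,y)=2^{-n}$, where $n$ is the least nonnegative integer with $x_n\neq y_n$ or $x_{-n}\neq y_{-n}$. The shift is $\sigma(x)_i=x_{i+1}$. A subshift is a closed set $\Sigma\subseteq A^{\mathbb Z}$ with $\sigma(\Sigma)=\Sigma$; its language $\mathcal{L}(\Sigma)$ is the set of all finite factors (including the empty word) of elements of $\Sigma$, and it determines $\Sigma$ uniquely. (A language is central if it is closed under factors and every $v$ in it has an extension $uvw$ in it with $u,w$ nonempty.) For $\epsilon>0$, an $\epsilon$-chain in $\Sigma$ of length $n>0$ from $x^0$ to $x^n$ is a sequence $x^0,\dots,x^n\in\Sigma$ with $\rho(\sigma(x^i),x^{i+1})<\epsilon$ for all $i=0,1,\dots,n-1$. $\Sigma$ is chain-mixing if for all $x,y\in\Sigma$ and every $\epsilon>0$ there is $k\in\mathbb N$ such that for every $n>k$ there is an $\epsilon$-chain in $\Sigma$ of length $n$ from $x$ to $y$. Labelled graphs. A labelled graph $G$ over $A$ is a finite directed multigraph (loops and parallel edges allowed) whose edges $e$ carry labels $l(e)\in A$. $\Sigma(G)$ is the subshift of all $x\in A^{\mathbb Z}$ for which there is a biinfinite walk with edges $(e_i)_{i\in\mathbb Z}$ in $G$ with $l(e_i)=x_i$ for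 all $i$, and $\mathcal{L}(G)=\mathcal{L}(\Sigma(G))$. $G$ is essential if every vertex has at least one outgoing and at least one ingoing edge (a loop counts as both). "Connected" means strongly connected: for all vertices $u,v$ there is a walk from $u$ to $v$, walks of length zero being allowed. A labelled graph is periodic if its vertex set can be partitioned into $n>1$ disjoint (nonempty) sets $V_0,\dots,V_{n-1}$ such that every edge leads from some vertex of $V_k$ to some vertex of $V_{k+1}$ for a suitable $k$ (with $V_n=V_0$); it is aperiodic if it is not periodic. The components of a graph are its maximal connected subgraphs; each vertex lies in exactly one. Linking graph. For a vertex $v$ of $G$ lying in the component $K$ of $G$, the restricted follower set $F(v)$ is the set of all finite words spelled by the labels of walks starting at $v$ and staying in $K$. Vertices $v,w$ are linked, $v\sim w$, if $|F(v)\cap F(w)|=\infty$. Let $\approx$ be the transitive and reflexive closure of $\sim$. The linking graph $G/_\approx$ has as vertices the equivalence classes of $\approx$ on $V(G)$, and there is an edge labelled $a$ from class $X$ to class $Y$ iff there are $u\in X$, $v\in Y$ and an edge labelled $a$ from $u$ to $v$ in $G$. *)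

theory Defs
  imports "HOL-Analysis.Abstract_Metric_Spaces" "Graph_Theory.Digraph_Component" "Graph_Theory.Arc_Walk"
begin

section \<open>Subshifts\<close>

text \<open>A configuration in \<open>A\<^sup>\<int>\<close> is a function \<open>int \<Rightarrow> 'a\<close>; the finite alphabet is the type \<open>'a\<close>.\<close>

definition rho :: "(int \<Rightarrow> 'a) \<Rightarrow> (int \<Rightarrow> 'a) \<Rightarrow> real" where
  "rho x y = (if x = y then 0
     else 1 / 2 ^ (LEAST n. x (int n) \<noteq> y (int n) \<or> x (- int n) \<noteq> y (- int n)))"

lemma rho_less_iff:
  "rho x y < 1 / 2 ^ n \<longleftrightarrow> (\<forall>m\<le>n. x (int m) = y (int m) \<and> x (- int m) = y (- int m))"
proof (cases "x = y")
  case False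
  let ?P = "\<lambda>n. x (int n) \<noteq> y (int n) \<or> x (- int n) \<noteq> y (- int n)"
  from False obtain i where i: "x i \<noteq> y i" by blast
  have ex: "?P (nat \<bar>i\<bar>)" using i by (cases "i \<ge> 0") auto
  have P: "?P (Least ?P)" using ex by (rule LeastI)
  have "rho x y < 1 / 2 ^ n \<longleftrightarrow> n < Least ?P"
    using False by (simp add: rho_def divide_simps)
  also have "\<dots> \<longleftrightarrow> (\<forall>m\<le>n. \<not> ?P m)"
    by (metis (mono_tags, lifting) P not_less_Least leI le_less_trans)
  finally show ?thesis by blast
qed (simp add: rho_def)

lemma Metric_space_rho: "Metric_space UNIV rho"
proof
  fix x y z :: "int \<Rightarrow> 'a"
  show "0 \<le> rho x y" by (simp add: rho_def)
  show "rho x y = rho y x" by (auto simp: rho_def eq_commute)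
  show "rho x y = 0 \<longleftrightarrow> x = y" by (simp add: rho_def)
  show "rho x z \<le> rho x y + rho y z"
  proof (cases "x = z")
    case False
    then obtain n where n: "rho x z = 1 / 2 ^ n" by (auto simp: rho_def)
    have "\<not> rho x z < 1 / 2 ^ n" using n by simp
    then have "\<not> rho x y < 1 / 2 ^ n \<or> \<not> rho y z < 1 / 2 ^ n"
      unfolding rho_less_iff by metis
    moreover have "0 \<le> rho x y" "0 \<le> rho y z" by (simp_all add: rho_def)
    ultimately show ?thesis using n by linarith
  qed (simp add: rho_def)
qed

definition shift :: "(int \<Rightarrow> 'a) \<Rightarrow> (int \<Rightarrow> 'a)" where
  "shift x = (\<lambda>i. x (i + 1))"

definition subshift :: "(int \<Rightarrow> 'a) set \<Rightarrow> bool" where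
  "subshift S \<longleftrightarrow> closedin (Metric_space.mtopology UNIV rho) S \<and> shift ` S = S"

text \<open>The empty subshift has no elements, hence no factors: its language is empty.\<close>

definition language :: "(int \<Rightarrow> 'a) set \<Rightarrow> 'a list set" where
  "language S = {map (\<lambda>k. x (i + int k)) [0..<n] | x i n. x \<in> S}"

definition eps_chain ::
    "(int \<Rightarrow> 'a) set \<Rightarrow> real \<Rightarrow> nat \<Rightarrow> (int \<Rightarrow> 'a) \<Rightarrow> (int \<Rightarrow> 'a) \<Rightarrow> (nat \<Rightarrow> int \<Rightarrow> 'a) \<Rightarrow> bool" where
  "eps_chain S \<epsilon> n x y c \<longleftrightarrow>
     n > 0 \<and> c 0 = x \<and> c n = y \<and> (\<forall>i\<le>n. c i \<in> S) \<and>
     (\<forall>i<n. rho (shift (c i)) (c (Suc i)) < \<epsilon>)"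

definition chain_mixing :: "(int \<Rightarrow> 'a) set \<Rightarrow> bool" where
  "chain_mixing S \<longleftrightarrow>
     (\<forall>x\<in>S. \<forall>y\<in>S. \<forall>\<epsilon>>0. \<exists>k::nat. \<forall>n>k. \<exists>c. eps_chain S \<epsilon> n x y c)"

section \<open>Labelled graphs\<close>

text \<open>A labelled graph is a finite digraph \<open>G\<close> (loops and parallel arcs allowed) together with a
  labelling \<open>l\<close> of its arcs.\<close>

definition essential :: "('v, 'e) pre_digraph \<Rightarrow> bool" where
  "essential G \<longleftrightarrow>
     (\<forall>v\<in>verts G. (\<exists>e\<in>arcs G. tail G e = v) \<and> (\<exists>e\<in>arcs G. head G e = v))"

text \<open>Unlike \<^const>\<open>strongly_connected\<close>, this holds for the graph without vertices.\<close>

definition connected_graph :: "('v, 'e) pre_digraph \<Rightarrow> bool" where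
  "connected_graph G \<longleftrightarrow> (\<forall>u\<in>verts G. \<forall>v\<in>verts G. u \<rightarrow>\<^sup>*\<^bsub>G\<^esub> v)"

definition periodic_graph :: "('v, 'e) pre_digraph \<Rightarrow> bool" where
  "periodic_graph G \<longleftrightarrow>
     (\<exists>(n::nat) V. n > 1 \<and> (\<forall>k<n. V k \<noteq> {}) \<and>
        (\<forall>j<n. \<forall>k<n. j \<noteq> k \<longrightarrow> V j \<inter> V k = {}) \<and> (\<Union>k<n. V k) = verts G \<and>
        (\<forall>e\<in>arcs G. \<exists>k<n. tail G e \<in> V k \<and> head G e \<in> V (Suc k mod n)))"

definition graph_shift :: "('v, 'e) pre_digraph \<Rightarrow> ('e \<Rightarrow> 'a) \<Rightarrow> (int \<Rightarrow> 'a) set" where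
  "graph_shift G l =
     {x. \<exists>e. (\<forall>i. e i \<in> arcs G \<and> head G (e i) = tail G (e (i + 1))) \<and> (\<forall>i. l (e i) = x i)}"

section \<open>The linking graph\<close>

definition follower :: "('v, 'e) pre_digraph \<Rightarrow> ('e \<Rightarrow> 'a) \<Rightarrow> 'v \<Rightarrow> 'a list set" where
  "follower G l v =
     {map l p | p w K. K \<in> pre_digraph.sccs G \<and> v \<in> verts K \<and> pre_digraph.awalk K v p w}"

definition linked :: "('v, 'e) pre_digraph \<Rightarrow> ('e \<Rightarrow> 'a) \<Rightarrow> 'v rel" where
  "linked G l =
     {(v, w). v \<in> verts G \<and> w \<in> verts G \<and> infinite (follower G l v \<inter> follower G l w)}"

text \<open>An arc of the linking graph is a triple (source class, label, target class).
  The classes of \<open>(linked G l)\<^sup>*\<close> of vertices of \<open>G\<close> contain only vertices of \<open>G\<close>.\<close>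

definition linking_graph ::
    "('v, 'e) pre_digraph \<Rightarrow> ('e \<Rightarrow> 'a) \<Rightarrow> ('v set, 'v set \<times> 'a \<times> 'v set) pre_digraph" where
  "linking_graph G l =
     \<lparr> verts = verts G // (linked G l)\<^sup>*,
       arcs = {(X, a, Y). X \<in> verts G // (linked G l)\<^sup>* \<and> Y \<in> verts G // (linked G l)\<^sup>* \<and>
                 (\<exists>e\<in>arcs G. tail G e \<in> X \<and> head G e \<in> Y \<and> l e = a)},
       tail = (\<lambda>(X, a, Y). X),
       head = (\<lambda>(X, a, Y). Y) \<rparr>"

end

theory Submission
  imports Defs "HOL-Number_Theory.Cong"
begin

text \<open>
  A chain with error below \<open>2\<^sup>-\<^sup>m\<close> is a sequence of configurations in which each one agrees, on
  the window \<open>[-m, m]\<close>, with the shift of its predecessor.  Chain-mixing thus says that, for every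
  \<open>m\<close>, this one-step relation on the subshift admits walks of every large length between any two
  points (\<open>chain_mixing_iff_step\<close>).  Approximating points by label sequences of biinfinite walks
  in the graph, one may think of a chain as a walk that is sometimes allowed to change its
  track, provided that the old and the new track carry the same labels for a long time.  The linking
  graph records which changes are possible.

  From chains to the linking graph: if two biinfinite walks in \<open>G\<close> carry the same labels for \<open>|V|\<^sup>2\<close>
  steps, then by pigeonhole their pair of current vertices repeats.  The two walks thereby traverse
  closed walks with equal labels, and iterating these closed walks shows that the two current vertices
  are linked.  So within that time one can change from one walk to the other by passing to a
  linked vertex, which costs no time in the linking graph.  A chain of length \<open>n\<close> whose window is
  large enough hence yields a walk of length exactly \<open>n\<close> in the linking graph (\<open>chain_walk\<close>);
  connectedness and aperiodicity follow.

  From the linking graph to chains: a strongly connected relation that is not mixing has a phase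
  modulo some \<open>p > 1\<close> that increases by one along every step (\<open>mixing_or_periodic\<close>).  It is therefore
  enough to prove that the chain relation is strongly connected and to rule out phases.  Both
  arguments transport information from configurations to vertices by splicing the past of one
  walk to the future of another.  Reachability by chains is inherited by out-neighbours and by linked
  vertices, for which a common word longer than the window is used to change the track
  (\<open>linking_connected_imp_chains\<close>).  A phase of configurations induces a phase of vertices which is
  constant on linked vertices, hence a periodic partition of the linking graph
  (\<open>linking_periodic_of_phase\<close>).

  What the arguments use about the subshift is collected in the locale \<open>graph_subshift\<close>.  Every subshift with the right language has them, and the set of all configurations
  whose factors lie in the language is such a subshift, so no compactness argument is required.
\<close>

section \<open>Strongly connected relations: mixing or periodic\<close>

lemma relpow_trans:
  "(a, b) \<in> R ^^ m \<Longrightarrow> (b, c) \<in> R ^^ n \<Longrightarrow> (a, c) \<in> R ^^ (m + n)"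
  by (auto simp: relpow_add)

lemma relpow_cycle_mult:
  assumes "(a, a) \<in> R ^^ t"
  shows "(a, a) \<in> R ^^ (k * t)"
proof (induction k)
  case (Suc k)
  then show ?case using relpow_trans[OF assms Suc] by simp
qed simp

text \<open>
  The lengths of closed walks at a point \<open>c\<close> form an additive monoid.  Let \<open>g\<close> be the least positive
  difference of two such lengths; it divides all of them.  If \<open>g = 1\<close>, two consecutive lengths generate
  all large numbers; otherwise the length of any walk from \<open>c\<close> to \<open>b\<close>, taken modulo \<open>g\<close>, is a
  well-defined phase of \<open>b\<close>.
\<close>

lemma mixing_or_periodic:
  fixes R :: "'s rel" and S :: "'s set"
  assumes sub: "R \<subseteq> S \<times> S"
    and total: "\<And>a. a \<in> S \<Longrightarrow> \<exists>b. (a, b) \<in> R"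
    and conn: "\<And>a b. a \<in> S \<Longrightarrow> b \<in> S \<Longrightarrow> (a, b) \<in> R\<^sup>*"
  shows "(\<forall>a\<in>S. \<forall>b\<in>S. \<exists>k. \<forall>n>k. (a, b) \<in> R ^^ n) \<or>
    (\<exists>p \<phi>. 1 < (p::nat) \<and> (\<forall>a b. (a, b) \<in> R \<longrightarrow> \<phi> b = Suc (\<phi> a) mod p) \<and> (\<forall>a. \<phi> a < p))"
proof (cases "S = {}")
  case False
  then obtain c where c: "c \<in> S" by blast
  define T where "T = {n. (c, c) \<in> R ^^ n}"
  have add: "m + n \<in> T" if "m \<in> T" "n \<in> T" for m n
    using that by (auto simp: T_def intro: relpow_trans)
  have mult: "k * t \<in> T" if "t \<in> T" for k t
    using that by (auto simp: T_def intro: relpow_cycle_mult)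
  have walk: "\<exists>n. (a, b) \<in> R ^^ n" if "a \<in> S" "b \<in> S" for a b
    using conn[OF that] by (simp add: rtrancl_imp_relpow)
  obtain b where b: "(c, b) \<in> R" using total c by blast
  then obtain n where "(b, c) \<in> R ^^ n" using walk sub c by blast
  then have "Suc n \<in> T" unfolding T_def using relpow_Suc_I2[OF b] by blast
  moreover have "0 \<in> T" by (simp add: T_def)
  ultimately have ex: "\<exists>g>0. \<exists>j. j \<in> T \<and> j + g \<in> T" by (metis add_0 zero_less_Suc)
  define g where "g = (LEAST g. 0 < g \<and> (\<exists>j. j \<in> T \<and> j + g \<in> T))"
  have g: "0 < g \<and> (\<exists>j. j \<in> T \<and> j + g \<in> T)"
    unfolding g_def by (rule LeastI_ex) (use ex in blast)
  then obtain j where j: "j \<in> T" "j + g \<in> T" and "0 < g" by blast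
  have least: "g \<le> d" if "0 < d" "i \<in> T" "i + d \<in> T" for i d
    unfolding g_def by (rule Least_le) (use that in blast)
  have dvd: "g dvd t" if "t \<in> T" for t
  proof (rule ccontr)
    assume "\<not> g dvd t"
    then have r: "0 < t mod g" by (simp add: dvd_eq_mod_eq_0)
    \<comment> \<open>Both \<open>q (j + g)\<close> and \<open>q j + t\<close>, where \<open>q = t div g\<close>, are lengths; they differ by \<open>t mod g\<close>.\<close>
    have "t div g * (j + g) \<in> T" using j mult by blast
    moreover have "t div g * j + t \<in> T" using j that mult add by blast
    moreover have "t div g * j + t = t div g * (j + g) + t mod g"
      using div_mult_mod_eq[of t g] by (simp add: distrib_left)
    ultimately have "g \<le> t mod g" using least[OF r] by simp
    then show False using mod_less_divisor[OF \<open>0 < g\<close>, of t] by linarith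
  qed
  show ?thesis
  proof (cases "g = 1")
    case True
    \<comment> \<open>With \<open>q = n div j\<close> and \<open>r = n mod j\<close>, where \<open>r < j \<le> q\<close>: \<open>n = (q - r) j + r (j + 1)\<close>.\<close>
    have large: "n \<in> T" if "j * j \<le> n" for n
    proof (cases "j = 0")
      case True
      then show ?thesis using j \<open>g = 1\<close> mult[of 1 n] by simp
    next
      case False
      have "j \<le> n div j" using False that div_le_mono[of "j * j" n j] by simp
      then have "n mod j \<le> n div j" using mod_less_divisor[of j n] False by linarith
      then obtain d where d: "n div j = n mod j + d" using le_Suc_ex by blast
      then have "(n div j - n mod j) * j + n mod j * (j + 1) = n div j * j + n mod j"
        by (simp add: algebra_simps)
      also have "\<dots> = n" by simp
      finally have n: "(n div j - n mod j) * j + n mod j * (j + 1) = n" .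
      have "j + 1 \<in> T" using j(2) \<open>g = 1\<close> by simp
      then show ?thesis using add[OF mult[OF j(1)] mult, of "j + 1"] by (subst n[symmetric])
    qed
    have "\<exists>k. \<forall>n>k. (a, b) \<in> R ^^ n" if ab: "a \<in> S" "b \<in> S" for a b
    proof -
      obtain r s where r: "(a, c) \<in> R ^^ r" and s: "(c, b) \<in> R ^^ s"
        using walk ab c by blast
      have "(a, b) \<in> R ^^ n" if "n > r + j * j + s" for n
      proof -
        have "n - r - s \<in> T" using that by (intro large) linarith
        then have "(a, b) \<in> R ^^ (r + (n - r - s) + s)"
          using relpow_trans[OF relpow_trans[OF r] s] by (simp add: T_def)
        then show ?thesis using that by simp
      qed
      then show ?thesis by blast
    qed
    then show ?thesis by blast
  next
    case False
    define \<phi> where "\<phi> = (\<lambda>b. (SOME n. (c, b) \<in> R ^^ n) mod g)"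
    have \<phi>: "\<phi> b = n mod g" if n: "(c, b) \<in> R ^^ n" and b: "b \<in> S" for b n
    proof -
      define m where "m = (SOME n. (c, b) \<in> R ^^ n)"
      have m: "(c, b) \<in> R ^^ m" unfolding m_def using n by (rule someI)
      obtain r where r: "(b, c) \<in> R ^^ r" using walk b c by blast
      have "g dvd m + r" "g dvd n + r"
        using relpow_trans[OF m r] relpow_trans[OF n r] dvd by (simp_all add: T_def)
      then have "[m + r = n + r] (mod g)" unfolding cong_def by (simp only: dvd_eq_mod_eq_0)
      then have "[m = n] (mod g)" by (simp add: cong_add_rcancel_nat)
      then show ?thesis by (simp add: \<phi>_def m_def cong_def)
    qed
    have "\<phi> b = Suc (\<phi> a) mod g" if "(a, b) \<in> R" for a b
    proof -
      have ab: "a \<in> S" "b \<in> S" using that sub by auto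
      obtain n where n: "(c, a) \<in> R ^^ n" using walk ab c by blast
      then have "(c, b) \<in> R ^^ Suc n" using that by auto
      then show ?thesis using \<phi>[OF _ ab(2)] \<phi>[OF n ab(1)] by (simp add: mod_Suc_eq)
    qed
    moreover have "1 < g" using False \<open>0 < g\<close> by linarith
    moreover have "\<forall>a. \<phi> a < g" using \<open>0 < g\<close> by (simp add: \<phi>_def)
    ultimately show ?thesis by blast
  qed
qed simp

section \<open>Chains as walks of a relation\<close>

definition agree :: "nat \<Rightarrow> (int \<Rightarrow> 'a) \<Rightarrow> (int \<Rightarrow> 'a) \<Rightarrow> bool" where
  "agree m x y \<longleftrightarrow> (\<forall>i. \<bar>i\<bar> \<le> int m \<longrightarrow> x i = y i)"

lemma agreeD: "agree m x y \<Longrightarrow> \<bar>i\<bar> \<le> int m \<Longrightarrow> x i = y i"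
  by (simp add: agree_def)

lemma agree_refl: "agree m x x"
  by (simp add: agree_def)

lemma agree_sym: "agree m x y \<Longrightarrow> agree m y x"
  by (simp add: agree_def)

lemma agree_trans: "agree m x y \<Longrightarrow> agree m y z \<Longrightarrow> agree m x z"
  by (simp add: agree_def)

lemma rho_less_iff_agree: "rho x y < 1 / 2 ^ m \<longleftrightarrow> agree m x y"
  unfolding rho_less_iff
proof
  assume *: "\<forall>k\<le>m. x (int k) = y (int k) \<and> x (- int k) = y (- int k)"
  show "agree m x y"
    unfolding agree_def
  proof (intro allI impI)
    fix i :: int assume "\<bar>i\<bar> \<le> int m"
    then show "x i = y i" using *[rule_format, of "nat \<bar>i\<bar>"] by (cases "i \<ge> 0") auto
  qed
next
  assume *: "agree m x y"
  show "\<forall>k\<le>m. x (int k) = y (int k) \<and> x (- int k) = y (- int k)"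
    using agreeD[OF *, of "int k" for k] agreeD[OF *, of "- int k" for k] by simp
qed

definition translate :: "int \<Rightarrow> (int \<Rightarrow> 'a) \<Rightarrow> int \<Rightarrow> 'a" where
  "translate k x = (\<lambda>i. x (i + k))"

lemma translate_apply [simp]: "translate k x i = x (i + k)"
  by (simp add: translate_def)

lemma translate_translate [simp]: "translate j (translate k x) = translate (j + k) x"
  by (simp add: translate_def ac_simps)

lemma translate_0 [simp]: "translate 0 x = x"
  by (simp add: translate_def)

lemma shift_eq_translate: "shift = translate 1"
  by (simp add: shift_def translate_def fun_eq_iff)

definition step :: "(int \<Rightarrow> 'a) set \<Rightarrow> nat \<Rightarrow> (int \<Rightarrow> 'a) rel" where
  "step S m = {(x, y). x \<in> S \<and> y \<in> S \<and> agree m (translate 1 x) y}"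

lemma eps_chain_mono: "eps_chain S \<delta> n x y c \<Longrightarrow> \<delta> \<le> \<epsilon> \<Longrightarrow> eps_chain S \<epsilon> n x y c"
  unfolding eps_chain_def by (meson less_le_trans)

lemma ex_eps_chain_iff:
  assumes "x \<in> S"
  shows "(\<exists>c. eps_chain S (1 / 2 ^ m) n x y c) \<longleftrightarrow> 0 < n \<and> (x, y) \<in> step S m ^^ n"
proof -
  have in_S: "\<forall>i\<le>n. c i \<in> S" if "\<forall>i<n. (c i, c (Suc i)) \<in> step S m" "c 0 \<in> S" for c
  proof safe
    fix i assume "i \<le> n"
    then show "c i \<in> S"
    proof (cases i)
      case (Suc j)
      then have "(c j, c i) \<in> step S m" using that(1) \<open>i \<le> n\<close> by simp
      then show ?thesis by (simp add: step_def)
    qed (use that in simp)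
  qed
  have "(\<forall>i<n. (c i, c (Suc i)) \<in> step S m) \<longleftrightarrow>
      (\<forall>i<n. agree m (translate 1 (c i)) (c (Suc i)))" if "\<forall>i\<le>n. c i \<in> S" for c
    using that by (simp add: step_def Suc_le_eq)
  then show ?thesis
    unfolding eps_chain_def relpow_fun_conv rho_less_iff_agree shift_eq_translate
    using assms in_S by blast
qed

lemma chain_mixing_iff_step:
  "chain_mixing S \<longleftrightarrow> (\<forall>m. \<forall>x\<in>S. \<forall>y\<in>S. \<exists>k. \<forall>n>k. (x, y) \<in> step S m ^^ n)"
proof
  assume L: "chain_mixing S"
  show "\<forall>m. \<forall>x\<in>S. \<forall>y\<in>S. \<exists>k. \<forall>n>k. (x, y) \<in> step S m ^^ n"
  proof (intro allI ballI)
    fix m x y assume xy: "x \<in> S" "y \<in> S"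
    then obtain k where "\<forall>n>k. \<exists>c. eps_chain S (1 / 2 ^ m) n x y c"
      using L unfolding chain_mixing_def by (meson divide_pos_pos zero_less_numeral zero_less_one zero_less_power)
    then show "\<exists>k. \<forall>n>k. (x, y) \<in> step S m ^^ n"
      using ex_eps_chain_iff[OF xy(1)] by blast
  qed
next
  assume R: "\<forall>m. \<forall>x\<in>S. \<forall>y\<in>S. \<exists>k. \<forall>n>k. (x, y) \<in> step S m ^^ n"
  show "chain_mixing S"
    unfolding chain_mixing_def
  proof (intro ballI allI impI)
    fix x y and \<epsilon> :: real assume xy: "x \<in> S" "y \<in> S" and "\<epsilon> > 0"
    then obtain m where m: "1 / 2 ^ m \<le> \<epsilon>"
      using real_arch_pow_inv[of \<epsilon> "1 / 2"] by (auto simp: power_one_over intro: less_imp_le)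
    obtain k where k: "\<forall>n>k. (x, y) \<in> step S m ^^ n" using R xy by blast
    have "\<exists>c. eps_chain S \<epsilon> n x y c" if "n > k" for n
    proof -
      have "0 < n \<and> (x, y) \<in> step S m ^^ n" using k that by auto
      then show ?thesis using ex_eps_chain_iff[OF xy(1)] eps_chain_mono m by metis
    qed
    then show "\<exists>k. \<forall>n>k. \<exists>c. eps_chain S \<epsilon> n x y c" by blast
  qed
qed

text \<open>A coordinate survives along a chain, moving left by one at each step, as long as it stays in the
  window.  The bounds express that the positions from \<open>t - 1\<close> (after the first step) down to \<open>t - s\<close>
  (after the last one) lie in \<open>[-m, m]\<close>.\<close>

lemma step_relpow_agree:
  assumes "(x, y) \<in> step S m ^^ s" and "int s - int m \<le> t" and "t \<le> int m + 1"
  shows "x t = y (t - int s)"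
  using assms
proof (induction s arbitrary: y)
  case (Suc s)
  then obtain z where z: "(x, z) \<in> step S m ^^ s" "agree m (translate 1 z) y"
    by (auto simp: step_def)
  have "x t = z (t - int s)" using Suc.IH[OF z(1)] Suc.prems by simp
  also have "\<dots> = translate 1 z (t - int (Suc s))" by simp
  also have "\<dots> = y (t - int (Suc s))"
    by (rule agreeD[OF z(2)]) (use Suc.prems(2,3) in linarith)
  finally show ?case .
qed simp

section \<open>Biinfinite walks\<close>

locale essential_labelled_graph = fin_digraph G
  for G :: "('v, 'e) pre_digraph" (structure) +
  fixes l :: "'e \<Rightarrow> 'a::finite"
  assumes essential: "essential G"
begin

definition biwalk :: "(int \<Rightarrow> 'e) \<Rightarrow> bool" where
  "biwalk e \<longleftrightarrow> (\<forall>i. e i \<in> arcs G \<and> head G (e i) = tail G (e (i + 1)))"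

abbreviation labels :: "(int \<Rightarrow> 'e) \<Rightarrow> int \<Rightarrow> 'a" where
  "labels e \<equiv> (\<lambda>i. l (e i))"

abbreviation cls :: "'v \<Rightarrow> 'v set" where
  "cls v \<equiv> (linked G l)\<^sup>* `` {v}"

lemma graph_shift_eq: "graph_shift G l = {labels e | e. biwalk e}"
  unfolding graph_shift_def biwalk_def by (auto simp: fun_eq_iff) metis

lemma biwalk_tail_in_verts: "biwalk e \<Longrightarrow> tail G (e i) \<in> verts G"
  by (simp add: biwalk_def)

lemma biwalk_translate: "biwalk e \<Longrightarrow> biwalk (translate k e)"
  unfolding biwalk_def by (simp add: algebra_simps)

lemma biwalk_splice:
  assumes "biwalk e" "biwalk f" "tail G (e k) = tail G (f k)"
  shows "biwalk (\<lambda>i. if i < k then e i else f i)"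
  unfolding biwalk_def
proof
  fix i
  consider "i + 1 < k" | "i + 1 = k" | "i \<ge> k" by linarith
  then show "(if i < k then e i else f i) \<in> arcs G \<and>
      head G (if i < k then e i else f i) = tail G (if i + 1 < k then e (i + 1) else f (i + 1))"
    using assms by cases (auto simp: biwalk_def)
qed

text \<open>Here essentiality enters: from \<open>v\<close> one follows chosen outgoing arcs forever, and chosen
  ingoing arcs backwards forever.\<close>

lemma biwalk_exists:
  assumes "v \<in> verts G"
  shows "\<exists>e. biwalk e \<and> tail G (e 0) = v"
proof -
  have "\<forall>v\<in>verts G. \<exists>e. e \<in> arcs G \<and> tail G e = v"
    and "\<forall>v\<in>verts G. \<exists>e. e \<in> arcs G \<and> head G e = v"
    using essential unfolding essential_def by blast+
  then obtain out inn where out: "\<And>v. v \<in> verts G \<Longrightarrow> out v \<in> arcs G \<and> tail G (out v) = v"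
    and inn: "\<And>v. v \<in> verts G \<Longrightarrow> inn v \<in> arcs G \<and> head G (inn v) = v"
    by metis
  define w where "w i = (if i \<ge> 0 then ((\<lambda>v. head G (out v)) ^^ nat i) v
      else ((\<lambda>v. tail G (inn v)) ^^ nat (- i)) v)" for i
  define e where "e i = (if i \<ge> 0 then out (w i) else inn (w (i + 1)))" for i
  have fwd: "((\<lambda>v. head G (out v)) ^^ n) v \<in> verts G" for n
    by (induction n) (use assms out in auto)
  have bwd: "((\<lambda>v. tail G (inn v)) ^^ n) v \<in> verts G" for n
    by (induction n) (use assms inn in auto)
  have w: "w i \<in> verts G" for i using fwd bwd by (simp add: w_def)
  have tl: "tail G (e i) = w i" for i
  proof (cases "i \<ge> 0")
    case False
    then have "nat (- i) = Suc (nat (- (i + 1)))" by linarith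
    moreover have "w (i + 1) = ((\<lambda>v. tail G (inn v)) ^^ nat (- (i + 1))) v"
      using False by (cases "i = -1") (auto simp: w_def)
    ultimately show ?thesis using False by (simp add: e_def w_def)
  qed (use out w in \<open>simp add: e_def\<close>)
  have "head G (e i) = w (i + 1)" for i
  proof (cases "i \<ge> 0")
    case True
    then have "nat (i + 1) = Suc (nat i)" by linarith
    then show ?thesis using True by (simp add: e_def w_def)
  qed (use inn w in \<open>simp add: e_def\<close>)
  moreover have "e i \<in> arcs G" for i using out inn w by (simp add: e_def)
  ultimately have "biwalk e" using tl by (simp add: biwalk_def)
  moreover have "tail G (e 0) = v" using tl by (simp add: w_def)
  ultimately show ?thesis by blast
qed

lemma biwalk_through_arc:
  assumes "a \<in> arcs G" "biwalk f" "tail G (f 1) = head G a"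
  shows "\<exists>e. biwalk e \<and> e 0 = a \<and> (\<forall>i>0. e i = f i)"
proof -
  obtain b where b: "biwalk b" "tail G (b 0) = tail G a"
    using biwalk_exists assms(1) by (meson tail_in_verts)
  define e where "e i = (if i < 0 then b i else if i = 0 then a else f i)" for i
  have "biwalk e"
    unfolding biwalk_def
  proof
    fix i :: int
    consider "i < -1" | "i = -1" | "i = 0" | "i > 0" by linarith
    then show "e i \<in> arcs G \<and> head G (e i) = tail G (e (i + 1))"
    proof cases
      case 2
      have "e (-1) = b (-1)" "e (-1 + 1) = a" by (simp_all add: e_def)
      moreover have "b (-1) \<in> arcs G" "head G (b (-1)) = tail G (b (-1 + 1))"
        using b(1) unfolding biwalk_def by blast+
      ultimately show ?thesis using b(2) 2 by simp
    qed (use assms b in \<open>simp_all add: e_def biwalk_def\<close>)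
  qed
  then show ?thesis by (auto simp: e_def)
qed

lemma biwalk_extends_awalk:
  assumes "awalk v p w"
  shows "\<exists>e. biwalk e \<and> tail G (e 0) = v \<and> (\<forall>k<length p. e (int k) = p ! k) \<and>
    tail G (e (int (length p))) = w"
  using assms
proof (induction p arbitrary: v)
  case Nil
  then show ?case using biwalk_exists by (auto simp: awalk_Nil_iff)
next
  case (Cons a p)
  then have a: "a \<in> arcs G" "v = tail G a" and "awalk (head G a) p w"
    by (auto simp: awalk_Cons_iff)
  then obtain f where f: "biwalk f" "tail G (f 0) = head G a" "\<forall>k<length p. f (int k) = p ! k"
    "tail G (f (int (length p))) = w" using Cons.IH by blast
  then obtain e where e: "biwalk e" "e 0 = a" "\<forall>i>0. e i = f (i - 1)"
    using biwalk_through_arc[OF a(1) biwalk_translate, of f "-1"] by auto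
  have "e (int k) = (a # p) ! k" if "k < length (a # p)" for k
    using that e f by (cases k) auto
  then show ?case using e f a by (intro exI[of _ e]) auto
qed

lemma biwalk_segment:
  assumes "biwalk e"
  shows "awalk (tail G (e i)) (map (\<lambda>k. e (i + int k)) [0..<n]) (tail G (e (i + int n)))"
proof (induction n)
  case 0
  then show ?case using assms by (simp add: awalk_Nil_iff biwalk_tail_in_verts)
next
  case (Suc n)
  have "awalk (tail G (e (i + int n))) [e (i + int n)] (tail G (e (i + int (Suc n))))"
    using assms arc_implies_awalk[of "e (i + int n)"] by (simp add: biwalk_def algebra_simps)
  with Suc show ?case by (auto intro: awalk_appendI simp del: awalk_append_iff)
qed

section \<open>Linked vertices and walks in the linking graph\<close>

text \<open>A walk from \<open>v\<close> stays in the component of \<open>v\<close> iff its end point can reach \<open>v\<close> again.  The next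
  two lemmas replace components by this condition.\<close>

lemma followerD:
  assumes "z \<in> follower G l v"
  shows "\<exists>p w. awalk v p w \<and> w \<rightarrow>\<^sup>* v \<and> z = map l p"
proof -
  obtain p w K where z: "z = map l p" and K: "K \<in> sccs" "v \<in> verts K"
    and p: "pre_digraph.awalk K v p w"
    using assms unfolding follower_def by blast
  have sub: "subgraph K G" and sc: "strongly_connected K"
    using K in_sccsE induced_imp_subgraph by blast+
  interpret K: wf_digraph K using sub by blast
  have "w \<in> verts K" using p by blast
  then have "w \<rightarrow>\<^sup>*\<^bsub>K\<^esub> v" using sc K by blast
  then show ?thesis using sub p z reachable_mono subgraph_awalk_imp_awalk by blast
qed

lemma followerI:
  assumes "awalk v p w" "w \<rightarrow>\<^sup>* v"
  shows "map l p \<in> follower G l v"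
proof -
  have v: "v \<in> verts G" using assms by blast
  define K where "K = G \<restriction> scc_of v"
  have "K \<in> sccs" unfolding K_def using scc_of_in_sccs_verts[OF v] by (rule in_verts_sccsD_sccs)
  moreover have "v \<in> verts K" using in_scc_of_self[OF v] by (simp add: K_def)
  moreover have "set (awalk_verts v p) \<subseteq> scc_of v"
  proof
    fix u assume "u \<in> set (awalk_verts v p)"
    then obtain q r where "awalk v q u" "awalk u r w"
      using assms(1) awalk_decomp by blast
    then show "u \<in> scc_of v"
      using assms(2) reachable_trans unfolding scc_of_def by (blast intro: reachable_awalkI)
  qed
  then have "pre_digraph.awalk K v p w"
    unfolding K_def using assms(1) by (intro awalk_induce)
  ultimately show ?thesis unfolding follower_def by blast
qed

lemma linked_sym: "sym (linked G l)"
  by (auto simp: sym_def linked_def Int_commute)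

lemma equiv_linked: "equiv UNIV ((linked G l)\<^sup>*)"
  by (simp add: equiv_def refl_rtrancl sym_rtrancl linked_sym trans_rtrancl)

lemma cls_eq_iff: "cls v = cls w \<longleftrightarrow> (v, w) \<in> (linked G l)\<^sup>*"
  using eq_equiv_class_iff[OF equiv_linked] by simp

text \<open>Closed walks remain in the component of their base point, so all powers of the common
  label word belong to both follower sets.\<close>

lemma linked_of_closed_walks:
  assumes "awalk u p u" "awalk v q v" "map l p = map l q" "p \<noteq> []"
  shows "(u, v) \<in> linked G l"
proof -
  let ?pow = "\<lambda>k p. concat (replicate k p)"
  have pow: "awalk u (?pow k p) u" if "awalk u p u" for k u p
    by (induction k) (use that in \<open>auto simp: awalk_Nil_iff intro: awalk_appendI simp del: awalk_append_iff\<close>)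
  have "map l (?pow k p) \<in> follower G l u \<inter> follower G l v" for k
  proof -
    have "map l (?pow k p) = map l (?pow k q)"
      using assms(3) by (simp add: map_concat map_replicate)
    then show ?thesis
      using followerI[OF pow[OF assms(1)]] followerI[OF pow[OF assms(2)]] assms(1,2)
      by (metis IntI awalk_hd_in_verts reachable_refl)
  qed
  then have "range (\<lambda>k. map l (?pow k p)) \<subseteq> follower G l u \<inter> follower G l v" by blast
  moreover have "inj (\<lambda>k. map l (?pow k p))"
  proof (rule injI)
    fix j k assume "map l (?pow j p) = map l (?pow k p)"
    then have "length (?pow j p) = length (?pow k p)" by (metis length_map)
    then show "j = k" using assms(4) by (simp add: length_concat sum_list_replicate)
  qed
  ultimately have "infinite (follower G l u \<inter> follower G l v)"
    by (meson finite_subset range_inj_infinite)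
  then show ?thesis using assms(1,2) by (auto simp: linked_def)
qed

text \<open>Over a finite alphabet an infinite set of words contains arbitrarily long ones.\<close>

lemma linked_long_word:
  assumes "(v, w) \<in> linked G l"
  obtains z where "z \<in> follower G l v" "z \<in> follower G l w" "n \<le> length z"
proof -
  have "finite {z :: 'a list. length z \<le> n}"
    using finite_lists_length_le[of "UNIV :: 'a set" n] by simp
  moreover have "infinite (follower G l v \<inter> follower G l w)"
    using assms by (simp add: linked_def)
  ultimately have "\<not> follower G l v \<inter> follower G l w \<subseteq> {z. length z \<le> n}"
    by (meson finite_subset)
  then show ?thesis using that by force
qed

text \<open>The form in which linkedness is used: two walks starting at \<open>v\<close> and \<open>w\<close> show the same labels for
  as long as desired, after which the second one can still return to \<open>w\<close>.\<close>

lemma linked_biwalks: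
  assumes "(v, w) \<in> linked G l"
  obtains e f n where "biwalk e" "tail G (e 0) = v" "biwalk f" "tail G (f 0) = w"
    "\<And>i. 0 \<le> i \<Longrightarrow> i < int n \<Longrightarrow> l (e i) = l (f i)" "tail G (f (int n)) \<rightarrow>\<^sup>* w" "N \<le> n"
proof -
  obtain z where z: "z \<in> follower G l v" "z \<in> follower G l w" "N \<le> length z"
    using linked_long_word[OF assms] by blast
  obtain p v' where p: "awalk v p v'" "z = map l p" using followerD[OF z(1)] by blast
  obtain q w' where q: "awalk w q w'" "z = map l q" "w' \<rightarrow>\<^sup>* w" using followerD[OF z(2)] by blast
  obtain e where e: "biwalk e" "tail G (e 0) = v" "\<forall>k<length p. e (int k) = p ! k"
    using biwalk_extends_awalk[OF p(1)] by blast
  obtain f where f: "biwalk f" "tail G (f 0) = w" "\<forall>k<length q. f (int k) = q ! k"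
    "tail G (f (int (length q))) = w'"
    using biwalk_extends_awalk[OF q(1)] by blast
  have len: "length p = length z" "length q = length z" by (simp add: p(2), simp add: q(2))
  have "l (e i) = l (f i)" if "0 \<le> i" "i < int (length z)" for i
  proof -
    have "nat i < length z" using that by linarith
    then have "l (e (int (nat i))) = l (f (int (nat i)))"
      using e(3) f(3) len p(2) q(2) by (metis nth_map)
    then show ?thesis using that by simp
  qed
  then show thesis using that[OF e(1,2) f(1,2)] f(4) q(3) len(2) z(3) by metis
qed

lemma wf_linking_graph: "wf_digraph (linking_graph G l)"
  by unfold_locales (auto simp: linking_graph_def)

lemma linking_graph_verts: "verts (linking_graph G l) = cls ` verts G"
  by (auto simp: linking_graph_def quotient_def)

lemma linking_graph_arcs_ends:
  "arcs_ends (linking_graph G l) = {(cls (tail G a), cls (head G a)) | a. a \<in> arcs G}"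
proof -
  have "X = cls v" if "X \<in> verts G // (linked G l)\<^sup>*" "v \<in> X" for X v
    using that cls_eq_iff by (auto simp: quotient_def)
  moreover have "cls v \<in> verts G // (linked G l)\<^sup>*" "v \<in> cls v" if "v \<in> verts G" for v
    using that by (auto simp: quotient_def)
  ultimately show ?thesis
    by (fastforce simp: arcs_ends_conv linking_graph_def image_iff)
qed

lemma linking_graph_walk:
  assumes "biwalk e"
  shows "(cls (tail G (e i)), cls (tail G (e (i + int n)))) \<in> arcs_ends (linking_graph G l) ^^ n"
proof (induction n)
  case (Suc n)
  have "e (i + int n) \<in> arcs G"
    and "head G (e (i + int n)) = tail G (e (i + int (Suc n)))"
    using assms unfolding biwalk_def by (simp_all add: algebra_simps)
  then have "(cls (tail G (e (i + int n))), cls (tail G (e (i + int (Suc n))))) \<in> arcs_ends (linking_graph G l)"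
    unfolding linking_graph_arcs_ends by fastforce
  with Suc show ?case by auto
qed simp

text \<open>The walk \<open>f\<close> is compared with \<open>e\<close> at a delay of \<open>s\<close>, as happens for two members of a chain that are
  \<open>s\<close> steps apart.  Among the \<open>|V|\<^sup>2 + 1\<close> pairs of simultaneous vertices at times \<open>0, \<dots>, |V|\<^sup>2\<close> two
  coincide, which provides a pair of closed walks with equal labels and thus a time \<open>t\<close> at which the
  vertices of \<open>e\<close> and \<open>f\<close> are linked: follow \<open>e\<close> up to \<open>t\<close>, then \<open>f\<close>.\<close>

lemma linking_graph_jump:
  assumes e: "biwalk e" and f: "biwalk f"
    and s: "card (verts G) * card (verts G) \<le> s"
    and same: "\<And>t. t < card (verts G) * card (verts G) \<Longrightarrow> l (e (int t)) = l (f (int t - int s))"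
  shows "(cls (tail G (e 0)), cls (tail G (f 0))) \<in> arcs_ends (linking_graph G l) ^^ s"
proof -
  define N where "N = card (verts G) * card (verts G)"
  define h where "h t = (tail G (e (int t)), tail G (f (int t - int s)))" for t
  have "h ` {..N} \<subseteq> verts G \<times> verts G"
    using e f by (auto simp: h_def biwalk_tail_in_verts)
  then have "card (h ` {..N}) \<le> N"
    unfolding N_def using card_mono[OF finite_cartesian_product[OF finite_verts finite_verts]]
    by (metis card_cartesian_product)
  then have "\<not> inj_on h {..N}" by (intro pigeonhole) simp
  then obtain t t' where t: "t < t'" "t' \<le> N" "h t = h t'"
    unfolding inj_on_def by (metis atMost_iff linorder_neqE_nat)
  define p where "p = map (\<lambda>k. e (int t + int k)) [0..<t' - t]"
  define q where "q = map (\<lambda>k. f (int t - int s + int k)) [0..<t' - t]"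
  have "awalk (tail G (e (int t))) p (tail G (e (int t)))"
    using biwalk_segment[OF e, of "int t" "t' - t"] t by (simp add: p_def h_def)
  moreover have "awalk (tail G (f (int t - int s))) q (tail G (f (int t - int s)))"
    using biwalk_segment[OF f, of "int t - int s" "t' - t"] t by (simp add: q_def h_def)
  moreover have "map l p = map l q"
  proof -
    have "l (e (int t + int k)) = l (f (int t - int s + int k))" if "k < t' - t" for k
    proof -
      have "t + k < N" using that t by linarith
      then show ?thesis using same[of "t + k"] by (simp add: N_def algebra_simps)
    qed
    then show ?thesis by (simp add: p_def q_def)
  qed
  moreover have "p \<noteq> []" using t by (simp add: p_def)
  ultimately have "(tail G (e (int t)), tail G (f (int t - int s))) \<in> linked G l"
    by (rule linked_of_closed_walks)
  then have "cls (tail G (e (int t))) = cls (tail G (f (int t - int s)))"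
    unfolding cls_eq_iff by blast
  moreover have "t \<le> s" using t s by (simp add: N_def)
  moreover have "(cls (tail G (e 0)), cls (tail G (e (int t)))) \<in> arcs_ends (linking_graph G l) ^^ t"
    using linking_graph_walk[OF e, of 0 t] by simp
  moreover have "(cls (tail G (f (int t - int s))), cls (tail G (f 0)))
      \<in> arcs_ends (linking_graph G l) ^^ (s - t)"
    using linking_graph_walk[OF f, of "int t - int s" "s - t"] \<open>t \<le> s\<close> by (simp add: of_nat_diff)
  ultimately show ?thesis
    using relpow_trans[of _ _ t "arcs_ends (linking_graph G l)" _ "s - t"] by simp
qed

end

section \<open>From chain-mixing to the linking graph\<close>

text \<open>
  What both directions need to know about the subshift.  In the last assumption points are
  approximated on finite windows only: every point is in fact the label sequence of a
  biinfinite walk, but this would take a compactness argument.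
\<close>

locale graph_subshift = essential_labelled_graph G l
  for G :: "('v, 'e) pre_digraph" (structure) and l :: "'e \<Rightarrow> 'a::finite" +
  fixes S :: "(int \<Rightarrow> 'a) set"
  assumes translate_mem: "x \<in> S \<Longrightarrow> translate k x \<in> S"
    and labels_mem: "biwalk e \<Longrightarrow> labels e \<in> S"
    and approx: "x \<in> S \<Longrightarrow> \<exists>e. biwalk e \<and> agree m x (labels e)"
begin

text \<open>Between the two ends of a chain of length \<open>s < 2R\<close> the window \<open>[-2R, 2R]\<close> is wide enough for the
  coordinates \<open>0, \<dots>, R - 1\<close> of the first point to survive until the last one.\<close>

lemma short_chain_walk:
  assumes R: "R = Suc (card (verts G) * card (verts G))"
    and xy: "(x, y) \<in> step S (2 * R) ^^ s" and s: "R \<le> s" "s < 2 * R"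
    and e: "biwalk e" "agree (2 * R) x (labels e)"
    and f: "biwalk f" "agree (2 * R) y (labels f)"
  shows "(cls (tail G (e 0)), cls (tail G (f 0))) \<in> arcs_ends (linking_graph G l) ^^ s"
proof (rule linking_graph_jump[OF e(1) f(1)])
  show "card (verts G) * card (verts G) \<le> s" using R s by linarith
  fix t assume t: "t < card (verts G) * card (verts G)"
  then have "t < R" using R by simp
  have "l (e (int t)) = x (int t)" using agreeD[OF e(2), of "int t"] \<open>t < R\<close> by simp
  also have "\<dots> = y (int t - int s)"
    by (rule step_relpow_agree[OF xy]) (use s \<open>t < R\<close> in linarith)+
  also have "\<dots> = l (f (int t - int s))"
    by (rule agreeD[OF f(2)]) (use s \<open>t < R\<close> in linarith)
  finally show "l (e (int t)) = l (f (int t - int s))" .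
qed

text \<open>A long chain is cut into pieces of length \<open>R\<close> and one last piece of length between \<open>R\<close> and
  \<open>2R\<close>.  Every piece contributes one change of track.  Changing track at every single step of
  the chain would not do, since the times at which the vertices are linked need not be increasing.\<close>

lemma chain_walk:
  assumes R: "R = Suc (card (verts G) * card (verts G))"
    and x: "x \<in> S" and e: "biwalk e" "agree (2 * R) x (labels e)"
    and "(x, y) \<in> step S (2 * R) ^^ n" "R \<le> n"
    and "biwalk f" "agree (2 * R) y (labels f)"
  shows "(cls (tail G (e 0)), cls (tail G (f 0))) \<in> arcs_ends (linking_graph G l) ^^ n"
  using assms(5-)
proof (induction n arbitrary: y f rule: less_induct)
  case (less n)
  show ?case
  proof (cases "n < 2 * R")
    case True
    then show ?thesis using short_chain_walk[OF R _ _ _ e] less.prems by blast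
  next
    case False
    have "n = (n - R) + R" using less.prems by simp
    then obtain z where z: "(x, z) \<in> step S (2 * R) ^^ (n - R)" "(z, y) \<in> step S (2 * R) ^^ R"
      using less.prems(1) relpow_add[of "n - R" R "step S (2 * R)"] by auto
    obtain w where "(z, w) \<in> step S (2 * R)"
      using z(2) R by (metis relpow_Suc_D2)
    then have "z \<in> S" by (simp add: step_def)
    then obtain g where g: "biwalk g" "agree (2 * R) z (labels g)" using approx by blast
    have "(cls (tail G (e 0)), cls (tail G (g 0))) \<in> arcs_ends (linking_graph G l) ^^ (n - R)"
      using less.IH[of "n - R"] z(1) g False R by simp
    moreover have "(cls (tail G (g 0)), cls (tail G (f 0))) \<in> arcs_ends (linking_graph G l) ^^ R"
      using short_chain_walk[OF R z(2) _ _ g less.prems(3,4)] R by simp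
    ultimately have "(cls (tail G (e 0)), cls (tail G (f 0)))
        \<in> arcs_ends (linking_graph G l) ^^ (n - R + R)"
      by (rule relpow_trans)
    then show ?thesis using less.prems(2) by simp
  qed
qed

lemma chain_mixing_imp_linking_walks:
  assumes "chain_mixing S" "u \<in> verts G" "v \<in> verts G"
  shows "\<exists>k. \<forall>n>k. (cls u, cls v) \<in> arcs_ends (linking_graph G l) ^^ n"
proof -
  define R where R: "R = Suc (card (verts G) * card (verts G))"
  obtain e f where e: "biwalk e" "tail G (e 0) = u" and f: "biwalk f" "tail G (f 0) = v"
    using biwalk_exists assms by blast
  have S: "labels e \<in> S" "labels f \<in> S" using labels_mem e f by blast+
  then obtain k where "\<forall>n>k. (labels e, labels f) \<in> step S (2 * R) ^^ n"
    using assms(1) unfolding chain_mixing_iff_step by blast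
  then have "(cls u, cls v) \<in> arcs_ends (linking_graph G l) ^^ n" if "n > k + R" for n
    using chain_walk[OF R S(1) e(1) _ _ _ f(1), of "labels f" n] e f that by (simp add: agree_def)
  then show ?thesis by blast
qed

lemma chain_mixing_imp_connected:
  assumes "chain_mixing S"
  shows "connected_graph (linking_graph G l)"
proof -
  interpret H: wf_digraph "linking_graph G l" by (rule wf_linking_graph)
  have "cls u \<rightarrow>\<^sup>*\<^bsub>linking_graph G l\<^esub> cls v" if uv: "u \<in> verts G" "v \<in> verts G" for u v
  proof -
    obtain k where "(cls u, cls v) \<in> arcs_ends (linking_graph G l) ^^ (Suc k)"
      using chain_mixing_imp_linking_walks[OF assms uv] by blast
    then have "(cls u, cls v) \<in> (arcs_ends (linking_graph G l))\<^sup>*" by (rule relpow_imp_rtrancl)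
    then show ?thesis using uv by (simp add: H.reachable_conv linking_graph_verts)
  qed
  then show ?thesis by (auto simp: connected_graph_def linking_graph_verts)
qed

lemma chain_mixing_imp_aperiodic:
  assumes "chain_mixing S"
  shows "\<not> periodic_graph (linking_graph G l)"
proof
  let ?H = "linking_graph G l"
  assume "periodic_graph ?H"
  then obtain p :: nat and V where p: "1 < p" and ne: "\<forall>k<p. V k \<noteq> {}"
    and disj: "\<forall>j<p. \<forall>k<p. j \<noteq> k \<longrightarrow> V j \<inter> V k = {}" and un: "(\<Union>k<p. V k) = verts ?H"
    and arc: "\<forall>e\<in>arcs ?H. \<exists>k<p. tail ?H e \<in> V k \<and> head ?H e \<in> V (Suc k mod p)"
    unfolding periodic_graph_def by (elim exE conjE) (rule that)
  have unique: "j = k" if "X \<in> V j" "X \<in> V k" "j < p" "k < p" for X j k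
    using that disj by blast
  have walk: "Y \<in> V (n mod p)" if "(X, Y) \<in> arcs_ends ?H ^^ n" "X \<in> V 0" for X Y n
    using that(1)
  proof (induction n arbitrary: Y)
    case 0
    then show ?case using that(2) by simp
  next
    case (Suc n)
    then obtain Z where Z: "(X, Z) \<in> arcs_ends ?H ^^ n" "(Z, Y) \<in> arcs_ends ?H" by auto
    then obtain a where a: "a \<in> arcs ?H" "tail ?H a = Z" "head ?H a = Y"
      by (auto simp: arcs_ends_conv)
    then obtain k where k: "k < p" "Z \<in> V k" "Y \<in> V (Suc k mod p)" using arc by blast
    then have "k = n mod p" using unique[OF _ Suc.IH[OF Z(1)]] p by simp
    then show ?case using k(3) by (simp add: mod_Suc_eq)
  qed
  obtain X where X: "X \<in> V 0" using ne p by fastforce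
  then have "X \<in> verts ?H" using un p by force
  then obtain u where u: "u \<in> verts G" "X = cls u" by (auto simp: linking_graph_verts)
  obtain k where k: "\<forall>n>k. (X, X) \<in> arcs_ends ?H ^^ n"
    using chain_mixing_imp_linking_walks[OF assms u(1) u(1)] u(2) by blast
  define n where "n = Suc (p * k)"
  have "k < n" unfolding n_def using p mult_le_mono1[of 1 p k] by linarith
  then have "X \<in> V (n mod p)" using walk k X by blast
  moreover have "n mod p = 1" using p by (simp add: n_def mod_Suc)
  ultimately have "X \<in> V 1" by simp
  then show False using unique[OF X, of 1] p by simp
qed

section \<open>From the linking graph to chain-mixing\<close>

lemma step_translate: "x \<in> S \<Longrightarrow> (x, translate 1 x) \<in> step S m"
  using translate_mem by (simp add: step_def agree_refl)

text \<open>
  Let \<open>C\<close> be the set of points reachable from \<open>x\<close> by a chain of positive length.  Membership in \<open>C\<close>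
  depends only on the window \<open>[-m, m]\<close> and is preserved by the shift.  Call a vertex \<open>v\<close> good if
  every biinfinite walk passing through \<open>v\<close> at time \<open>0\<close> has entered \<open>C\<close> by time \<open>m\<close>, when the window
  only shows labels read after \<open>v\<close>; by splicing, the part before \<open>v\<close> may be chosen freely.  Goodness
  spreads along arcs.  If \<open>v\<close> is good and linked to \<open>w\<close>, then a walk from \<open>w\<close> reading a long common word
  enters \<open>C\<close> as well, so the vertex at the end of this word is good, and hence so is \<open>w\<close>, to which the
  walk can return.  As the linking graph is connected, all vertices are good.
\<close>

lemma linking_connected_imp_chains:
  assumes conn: "connected_graph (linking_graph G l)" and x: "x \<in> S" and y: "y \<in> S"
  shows "(x, y) \<in> (step S m)\<^sup>*"
proof -
  define C where "C = {z. (x, z) \<in> (step S m)\<^sup>+}"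
  have C_step: "w \<in> C" if "z \<in> C" "(z, w) \<in> step S m" for z w
    using that trancl_into_trancl unfolding C_def by fast
  have C_first: "z \<in> C" if "(x, z) \<in> step S m" for z
    using that unfolding C_def by fast
  have C_S: "z \<in> S" if z: "z \<in> C" for z
  proof -
    obtain w where "(w, z) \<in> step S m" using z tranclD2 unfolding C_def by fast
    then show ?thesis by (simp add: step_def)
  qed
  have C_agree: "z' \<in> C" if "z \<in> C" "agree m z z'" "z' \<in> S" for z z'
  proof -
    obtain w where w: "(x, w) \<in> (step S m)\<^sup>*" "(w, z) \<in> step S m"
      using \<open>z \<in> C\<close> tranclD2 unfolding C_def by fast
    then have "(w, z') \<in> step S m"
      using that agree_trans unfolding step_def by blast
    then show ?thesis using w(1) by (auto simp: C_def intro: rtrancl_into_trancl1)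
  qed
  have C_nat: "translate (int k) z \<in> C" if z: "z \<in> C" for z k
  proof (induction k)
    case (Suc k)
    then have "translate (int k) z \<in> S" using C_S by blast
    then have "(translate (int k) z, translate (int (Suc k)) z) \<in> step S m"
      using step_translate[of "translate (int k) z"] by simp
    then show ?case using Suc.IH C_step by blast
  qed (use z in simp)
  have C_translate: "translate k z \<in> C" if z: "translate j z \<in> C" and "j \<le> k" for j k z
    using C_nat[OF z, of "nat (k - j)"] that(2) by simp
  define good where
    "good v \<longleftrightarrow> (\<forall>f. biwalk f \<longrightarrow> tail G (f 0) = v \<longrightarrow> translate (int m) (labels f) \<in> C)" for v
  \<comment> \<open>A vertex is good once the past leading to it forces membership in \<open>C\<close>, whatever the future.\<close>
  have goodI: "good (tail G (e t))"
    if e: "biwalk e" and j: "j \<le> t + int m"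
      and h: "\<And>h. biwalk h \<Longrightarrow> \<forall>i<t. h i = e i \<Longrightarrow> translate j (labels h) \<in> C" for e t j
    unfolding good_def
  proof (intro allI impI)
    fix f assume f: "biwalk f" "tail G (f 0) = tail G (e t)"
    define h' where "h' = (\<lambda>i. if i < t then e i else translate (- t) f i)"
    have "biwalk h'" unfolding h'_def
      using f by (intro biwalk_splice e biwalk_translate) simp_all
    then have "translate j (labels h') \<in> C" using h by (simp add: h'_def)
    then have "translate (t + int m) (labels h') \<in> C" using C_translate j by blast
    moreover have "agree m (translate (t + int m) (labels h')) (translate (int m) (labels f))"
      by (simp add: agree_def h'_def algebra_simps)
    ultimately show "translate (int m) (labels f) \<in> C"
      using C_agree translate_mem labels_mem f(1) by blast
  qed
  have good_arc: "good (head G a)" if a: "a \<in> arcs G" and "good (tail G a)" for a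
  proof -
    obtain f where f: "biwalk f" "tail G (f 0) = head G a"
      using biwalk_exists a head_in_verts by blast
    then obtain e where e: "biwalk e" "e 0 = a" "\<forall>i>0. e i = translate (-1) f i"
      using biwalk_through_arc[OF a biwalk_translate[OF f(1)], of "-1"] by auto
    have "translate (int m) (labels h) \<in> C" if "biwalk h" "\<forall>i<1. h i = e i" for h
      using \<open>good (tail G a)\<close> that e(2) unfolding good_def by simp
    then have "good (tail G (e 1))" using e(1) by (intro goodI[of e "int m" 1]) auto
    then show ?thesis using e f by simp
  qed
  have good_reach: "good v" if "good u" "u \<rightarrow>\<^sup>* v" for u v
  proof -
    have "(u, v) \<in> (arcs_ends G)\<^sup>*" using that(2) by (simp add: reachable_conv)
    then show ?thesis using that(1)
      by (induction rule: rtrancl_induct) (auto simp: arcs_ends_conv good_arc)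
  qed
  have good_linked: "good w" if "good v" and link: "(v, w) \<in> linked G l" for v w
  proof -
    obtain e f n where e: "biwalk e" "tail G (e 0) = v" and f: "biwalk f" "tail G (f 0) = w"
      and same: "\<And>i. 0 \<le> i \<Longrightarrow> i < int n \<Longrightarrow> l (e i) = l (f i)"
      and ret: "tail G (f (int n)) \<rightarrow>\<^sup>* w" and n: "2 * m + 1 \<le> n"
      using linked_biwalks[OF link] by blast
    have eC: "translate (int m) (labels e) \<in> C" using \<open>good v\<close> e unfolding good_def by blast
    have "translate (int m) (labels h) \<in> C" if h: "biwalk h" "\<forall>i<int n. h i = f i" for h
    proof (rule C_agree[OF eC])
      show "agree m (translate (int m) (labels e)) (translate (int m) (labels h))"
        using same h(2) n by (simp add: agree_def)
      show "translate (int m) (labels h) \<in> S" using translate_mem labels_mem h(1) by blast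
    qed
    then have "good (tail G (f (int n)))" using f(1) by (intro goodI[of f "int m"]) auto
    then show ?thesis using good_reach ret by blast
  qed
  have good_cls: "good w" if "good v" "cls v = cls w" for v w
  proof -
    have "(v, w) \<in> (linked G l)\<^sup>*" using that(2) cls_eq_iff by blast
    then show ?thesis using that(1) by (induction rule: rtrancl_induct) (auto intro: good_linked)
  qed
  \<comment> \<open>One step of a chain uses the coordinates of \<open>x\<close> up to \<open>m + 1\<close>, so a walk approximating \<open>x\<close> makes its
    vertex at time \<open>m + 2\<close> good.\<close>
  obtain e where e: "biwalk e" "agree (Suc m) x (labels e)" using approx x by blast
  define t where "t = int m + 2"
  have "translate 1 (labels h) \<in> C" if h: "biwalk h" "\<forall>i<t. h i = e i" for h
  proof -
    have "agree m (translate 1 x) (translate 1 (labels h))"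
      using e(2) h(2) by (auto simp: agree_def t_def)
    then have "(x, translate 1 (labels h)) \<in> step S m"
      using x translate_mem labels_mem h(1) by (simp add: step_def)
    then show ?thesis by (rule C_first)
  qed
  then have good_t: "good (tail G (e t))"
    using e(1) by (intro goodI[of e 1]) (auto simp: t_def)
  obtain f where f: "biwalk f" "agree m y (labels f)" using approx y by blast
  interpret H: wf_digraph "linking_graph G l" by (rule wf_linking_graph)
  have good_all: "good v" if "v \<in> verts G" for v
  proof -
    have "cls (tail G (e t)) \<rightarrow>\<^sup>*\<^bsub>linking_graph G l\<^esub> cls v"
      using conn that e(1) by (simp add: connected_graph_def linking_graph_verts biwalk_tail_in_verts)
    then have "(cls (tail G (e t)), cls v) \<in> (arcs_ends (linking_graph G l))\<^sup>*"
      by (simp add: H.reachable_conv)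
    then have "\<forall>w. cls w = cls v \<longrightarrow> good w"
    proof (induction rule: rtrancl_induct)
      case base
      then show ?case using good_t good_cls by metis
    next
      case (step X Y)
      then obtain a where a: "a \<in> arcs G" "X = cls (tail G a)" "Y = cls (head G a)"
        by (auto simp: linking_graph_arcs_ends)
      then have "good (head G a)" using step.IH good_arc by blast
      then show ?case using a good_cls by metis
    qed
    then show ?thesis by blast
  qed
  \<comment> \<open>The window of \<open>y\<close> starts at time \<open>-m\<close>.\<close>
  have "good (tail G (f (- int m)))" using good_all f(1) biwalk_tail_in_verts by blast
  then have "translate (int m) (labels (translate (- int m) f)) \<in> C"
    using biwalk_translate[OF f(1), of "- int m"] unfolding good_def by (metis add_0 translate_apply)
  moreover have "translate (int m) (labels (translate (- int m) f)) = labels f"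
    by (simp add: fun_eq_iff)
  ultimately have "labels f \<in> C" by simp
  then have "y \<in> C" using C_agree agree_sym f(2) y by blast
  then show ?thesis by (simp add: C_def trancl_into_rtrancl)
qed

text \<open>
  The phase of a configuration depends only on its window, and translating changes it in a
  known way; so it can be read off from the distant past as well as from the distant future.
  Splicing shows that all walks through \<open>v\<close> at time \<open>0\<close> have the same phase, which is taken as the
  phase of \<open>v\<close>.
\<close>

lemma linking_periodic_of_phase:
  assumes p: "1 < (p::nat)" and \<phi>: "\<And>a b. (a, b) \<in> step S m \<Longrightarrow> \<phi> b = Suc (\<phi> a) mod p"
    and less: "\<And>a. \<phi> a < p" and x: "x \<in> S"
  shows "periodic_graph (linking_graph G l)"
proof -
  let ?H = "linking_graph G l"
  interpret H: wf_digraph ?H by (rule wf_linking_graph)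
  have tr1: "\<phi> (translate 1 z) = Suc (\<phi> z) mod p" if "z \<in> S" for z
    using \<phi>[OF step_translate[OF that]] .
  have tr: "\<phi> (translate (int k) z) = (\<phi> z + k) mod p" if z: "z \<in> S" for z k
  proof (induction k)
    case 0
    then show ?case using less by simp
  next
    case (Suc k)
    have "\<phi> (translate (int (Suc k)) z) = Suc (\<phi> (translate (int k) z)) mod p"
      using tr1[OF translate_mem[OF z, of "int k"]] by simp
    also have "\<phi> (translate (int k) z) = (\<phi> z + k) mod p" by (rule Suc.IH)
    finally show ?case by (simp add: mod_Suc_eq)
  qed
  have ag: "\<phi> z = \<phi> z'" if "z \<in> S" "z' \<in> S" "agree m z z'" for z z'
  proof -
    have "(translate (-1) z, z) \<in> step S m" "(translate (-1) z, z') \<in> step S m"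
      using that translate_mem by (simp_all add: step_def agree_def)
    then show ?thesis using \<phi> by metis
  qed
  have forward: "\<phi> z = \<phi> z'"
    if z: "z \<in> S" "z' \<in> S" "agree m (translate (int k) z) (translate (int k) z')" for z z' k
  proof -
    have "(\<phi> z + k) mod p = (\<phi> z' + k) mod p"
      using ag[OF translate_mem translate_mem] z tr by metis
    then have "[\<phi> z = \<phi> z'] (mod p)"
      using cong_add_rcancel_nat unfolding cong_def by blast
    then show ?thesis using less by (simp add: cong_def)
  qed
  have backward: "\<phi> z = \<phi> z'"
    if z: "z \<in> S" "z' \<in> S" "agree m (translate (- int k) z) (translate (- int k) z')" for z z' k
  proof -
    have "\<phi> (translate (- int k) z) = \<phi> (translate (- int k) z')"
      using ag translate_mem z by blast
    then show ?thesis
      using tr[OF translate_mem[OF z(1), of "- int k"], of k]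
        tr[OF translate_mem[OF z(2), of "- int k"], of k] by simp
  qed
  have same_phase: "\<phi> (labels e) = \<phi> (labels f)"
    if e: "biwalk e" and f: "biwalk f" and "tail G (e 0) = tail G (f 0)" for e f
  proof -
    define h where "h = (\<lambda>i. if i < 0 then e i else f i)"
    have h: "biwalk h" unfolding h_def using that by (rule biwalk_splice)
    have "\<phi> (labels e) = \<phi> (labels h)"
      by (rule backward[of _ _ "Suc m"]) (use e h labels_mem in \<open>auto simp: agree_def h_def\<close>)
    also have "\<dots> = \<phi> (labels f)"
      by (rule forward[of _ _ m]) (use f h labels_mem in \<open>auto simp: agree_def h_def\<close>)
    finally show ?thesis .
  qed
  define \<theta> where "\<theta> v = \<phi> (labels (SOME e. biwalk e \<and> tail G (e 0) = v))" for v
  have \<theta>: "\<theta> (tail G (e 0)) = \<phi> (labels e)" if e: "biwalk e" for e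
  proof -
    have "biwalk (SOME f. biwalk f \<and> tail G (f 0) = tail G (e 0)) \<and>
        tail G ((SOME f. biwalk f \<and> tail G (f 0) = tail G (e 0)) 0) = tail G (e 0)"
      by (rule someI[of _ e]) (use e in simp)
    then show ?thesis unfolding \<theta>_def using same_phase e by blast
  qed
  have \<theta>_translate: "\<theta> (tail G (e k)) = \<phi> (translate k (labels e))" if "biwalk e" for e k
    using \<theta>[OF biwalk_translate[OF that, of k]] by (simp add: translate_def)
  have \<theta>_arc: "\<theta> (head G a) = Suc (\<theta> (tail G a)) mod p" if a: "a \<in> arcs G" for a
  proof -
    obtain f where f: "biwalk f" "tail G (f 0) = head G a"
      using biwalk_exists a head_in_verts by blast
    then obtain e where e: "biwalk e" "e 0 = a" "\<forall>i>0. e i = translate (-1) f i"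
      using biwalk_through_arc[OF a biwalk_translate[OF f(1)], of "-1"] by auto
    then have "tail G (e 1) = head G a" using f by simp
    then show ?thesis
      using \<theta>[OF e(1)] \<theta>_translate[OF e(1), of 1] e(2) tr1[OF labels_mem[OF e(1)]] by simp
  qed
  have \<theta>_linked: "\<theta> v = \<theta> w" if link: "(v, w) \<in> linked G l" for v w
  proof -
    obtain e f n where e: "biwalk e" "tail G (e 0) = v" and f: "biwalk f" "tail G (f 0) = w"
      and same: "\<And>i. 0 \<le> i \<Longrightarrow> i < int n \<Longrightarrow> l (e i) = l (f i)" and n: "2 * m + 1 \<le> n"
      using linked_biwalks[OF link] by blast
    have "agree m (translate (int m) (labels e)) (translate (int m) (labels f))"
      using same n by (simp add: agree_def)
    then show ?thesis using forward labels_mem e f \<theta> by metis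
  qed
  have \<theta>_cls: "\<theta> v = \<theta> w" if "cls v = cls w" for v w
  proof -
    have "(v, w) \<in> (linked G l)\<^sup>*" using that cls_eq_iff by blast
    then show ?thesis by (induction rule: rtrancl_induct) (auto dest: \<theta>_linked)
  qed
  have \<theta>_less: "\<theta> v < p" for v by (simp add: \<theta>_def less)
  define V where "V k = {cls v | v. v \<in> verts G \<and> \<theta> v = k}" for k
  show ?thesis
    unfolding periodic_graph_def
  proof (intro exI conjI)
    show "1 < p" by (rule p)
    show "\<forall>k<p. V k \<noteq> {}"
    proof (intro allI impI)
      fix k assume "k < p"
      obtain e where e: "biwalk e" using approx x by blast
      \<comment> \<open>The phase is attained by waiting long enough on any walk.\<close>
      define i where "i = k + p - \<phi> (labels e)"
      have "\<theta> (tail G (e (int i))) = (\<phi> (labels e) + i) mod p"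
        using \<theta>_translate[OF e] tr[OF labels_mem[OF e]] by simp
      also have "\<dots> = k" using \<open>k < p\<close> less[of "labels e"] by (simp add: i_def)
      finally show "V k \<noteq> {}" using biwalk_tail_in_verts[OF e] by (auto simp: V_def)
    qed
    show "\<forall>j<p. \<forall>k<p. j \<noteq> k \<longrightarrow> V j \<inter> V k = {}"
    proof (intro allI impI equals0I)
      fix j k X assume "j \<noteq> k" "X \<in> V j \<inter> V k"
      then obtain v w where "X = cls v" "\<theta> v = j" "X = cls w" "\<theta> w = k" unfolding V_def by blast
      then show False using \<theta>_cls[of v w] \<open>j \<noteq> k\<close> by simp
    qed
    show "(\<Union>k<p. V k) = verts ?H"
      using \<theta>_less by (auto simp: V_def linking_graph_verts)
    show "\<forall>e\<in>arcs ?H. \<exists>k<p. tail ?H e \<in> V k \<and> head ?H e \<in> V (Suc k mod p)"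
    proof
      fix b assume "b \<in> arcs ?H"
      then have "(tail ?H b, head ?H b) \<in> arcs_ends ?H" by (rule H.in_arcs_imp_in_arcs_ends)
      then obtain a where a: "a \<in> arcs G" "tail ?H b = cls (tail G a)" "head ?H b = cls (head G a)"
        unfolding linking_graph_arcs_ends by blast
      have "tail ?H b \<in> V (\<theta> (tail G a))"
        unfolding V_def using a by (intro CollectI exI[of _ "tail G a"]) simp
      moreover have "head ?H b \<in> V (Suc (\<theta> (tail G a)) mod p)"
        unfolding V_def using a \<theta>_arc by (intro CollectI exI[of _ "head G a"]) simp
      ultimately show "\<exists>k<p. tail ?H b \<in> V k \<and> head ?H b \<in> V (Suc k mod p)" using \<theta>_less by blast
    qed
  qed
qed

lemma chain_mixing_iff:
  "chain_mixing S \<longleftrightarrow>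
    connected_graph (linking_graph G l) \<and> \<not> periodic_graph (linking_graph G l)"
proof
  assume "chain_mixing S"
  then show "connected_graph (linking_graph G l) \<and> \<not> periodic_graph (linking_graph G l)"
    using chain_mixing_imp_connected chain_mixing_imp_aperiodic by blast
next
  assume R: "connected_graph (linking_graph G l) \<and> \<not> periodic_graph (linking_graph G l)"
  show "chain_mixing S"
    unfolding chain_mixing_iff_step
  proof
    fix m
    have "(\<forall>x\<in>S. \<forall>y\<in>S. \<exists>k. \<forall>n>k. (x, y) \<in> step S m ^^ n) \<or>
      (\<exists>p \<phi>. 1 < (p::nat) \<and> (\<forall>x y. (x, y) \<in> step S m \<longrightarrow> \<phi> y = Suc (\<phi> x) mod p) \<and> (\<forall>x. \<phi> x < p))"
    proof (rule mixing_or_periodic)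
      show "step S m \<subseteq> S \<times> S" by (auto simp: step_def)
      show "\<exists>y. (x, y) \<in> step S m" if "x \<in> S" for x
        using step_translate that by blast
      show "(x, y) \<in> (step S m)\<^sup>*" if "x \<in> S" "y \<in> S" for x y
        using linking_connected_imp_chains R that by blast
    qed
    then show "\<forall>x\<in>S. \<forall>y\<in>S. \<exists>k. \<forall>n>k. (x, y) \<in> step S m ^^ n"
      using linking_periodic_of_phase R by metis
  qed
qed

end

section \<open>Subshifts with a given language\<close>

abbreviation factor :: "(int \<Rightarrow> 'a) \<Rightarrow> int \<Rightarrow> nat \<Rightarrow> 'a list" where
  "factor x i n \<equiv> map (\<lambda>k. x (i + int k)) [0..<n]"

lemma factor_eq_iff: "factor x i n = factor y j n \<longleftrightarrow> (\<forall>k<n. x (i + int k) = y (j + int k))"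
  by (auto simp: list_eq_iff_nth_eq)

lemma language_eq: "language S = {factor x i n | x i n. x \<in> S}"
  by (simp add: language_def)

lemma factor_in_language: "x \<in> S \<Longrightarrow> factor x i n \<in> language S"
  unfolding language_eq by blast

text \<open>If the central factor of \<open>x\<close> occurs somewhere in \<open>S\<close>, translation moves the occurrence to the centre.\<close>

lemma language_closed_agree:
  assumes "factor x (- int m) (2 * m + 1) \<in> language S"
    and "\<And>x k. x \<in> S \<Longrightarrow> translate k x \<in> S"
  shows "\<exists>y\<in>S. agree m x y"
proof -
  obtain y j n where y: "y \<in> S" "factor x (- int m) (2 * m + 1) = factor y j n"
    using assms(1) unfolding language_eq by blast
  have "n = 2 * m + 1" using arg_cong[OF y(2), of length] by simp
  then have eq: "\<forall>k<2 * m + 1. x (- int m + int k) = y (j + int k)"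
    using y(2) factor_eq_iff by blast
  have "x i = translate (j + int m) y i" if "\<bar>i\<bar> \<le> int m" for i
  proof -
    have k: "nat (i + int m) < 2 * m + 1" "int (nat (i + int m)) = i + int m" using that by linarith+
    show ?thesis using eq[rule_format, OF k(1)] k(2) by (simp add: ac_simps)
  qed
  then have "agree m x (translate (j + int m) y)" by (simp add: agree_def)
  then show ?thesis using assms(2) y(1) by blast
qed

lemma subshift_iff:
  "subshift S \<longleftrightarrow> (\<forall>x. (\<forall>m. \<exists>y\<in>S. agree m x y) \<longrightarrow> x \<in> S) \<and> translate 1 ` S = S"
proof -
  interpret Metric_space UNIV rho by (rule Metric_space_rho)
  have ball: "(\<exists>r>0. disjnt S (mball x r)) \<longleftrightarrow> (\<exists>m. \<forall>y\<in>S. \<not> agree m x y)" for x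
  proof
    assume "\<exists>r>0. disjnt S (mball x r)"
    then obtain r where r: "r > 0" "disjnt S (mball x r)" by blast
    obtain m where m: "1 / 2 ^ m < r"
      using real_arch_pow_inv[OF r(1), of "1 / 2"] by (auto simp: power_one_over)
    have "y \<notin> S" if "agree m x y" for y
    proof -
      have "rho x y < r" using that m rho_less_iff_agree[of x y m] by linarith
      then show ?thesis using r(2) by (auto simp: disjnt_iff)
    qed
    then show "\<exists>m. \<forall>y\<in>S. \<not> agree m x y" by blast
  next
    assume "\<exists>m. \<forall>y\<in>S. \<not> agree m x y"
    then obtain m where "\<forall>y\<in>S. \<not> rho x y < 1 / 2 ^ m"
      unfolding rho_less_iff_agree by blast
    then have "disjnt S (mball x (1 / 2 ^ m))" by (auto simp: disjnt_iff)
    then show "\<exists>r>0. disjnt S (mball x r)" by (intro exI[of _ "1 / 2 ^ m"]) simp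
  qed
  have "closedin mtopology S \<longleftrightarrow> (\<forall>x. x \<notin> S \<longrightarrow> (\<exists>m. \<forall>y\<in>S. \<not> agree m x y))"
    unfolding closedin_metric ball by simp
  then show ?thesis unfolding subshift_def shift_eq_translate by blast
qed

lemma translate_closed:
  assumes "translate 1 ` S = S" "x \<in> S"
  shows "translate k x \<in> S"
proof (induction k rule: int_induct[where k = 0])
  case base
  show ?case using assms(2) by simp
next
  case (step1 i)
  then have "translate 1 (translate i x) \<in> S" using assms(1) by blast
  moreover have "translate (i + 1) x = translate 1 (translate i x)" by (simp add: add.commute)
  ultimately show ?case by (simp only:)
next
  case (step2 i)
  then obtain y where y: "y \<in> S" "translate i x = translate 1 y" using assms(1) by blast
  have "translate (i - 1) x = translate (-1) (translate i x)" by simp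
  also have "\<dots> = y" by (simp add: y(2))
  finally show ?case using y(1) by (simp only:)
qed

context essential_labelled_graph
begin

text \<open>Equal languages mean that the points of \<open>S\<close> and the label sequences of biinfinite walks
  approximate each other on all windows; as \<open>S\<close> is closed, it contains those label sequences.\<close>

lemma graph_subshift_of_language:
  assumes S: "subshift S" and lang: "language S = language (graph_shift G l)"
  shows "graph_subshift G l S"
proof unfold_locales
  show tr: "translate k x \<in> S" if "x \<in> S" for x k
    using S translate_closed that unfolding subshift_iff by blast
  have tr': "translate k x \<in> graph_shift G l" if x: "x \<in> graph_shift G l" for x k
  proof -
    obtain e where e: "biwalk e" "x = labels e" using x unfolding graph_shift_eq by blast
    have "biwalk (translate k e)" by (rule biwalk_translate[OF e(1)])
    moreover have "translate k x = labels (translate k e)" by (simp add: e(2) fun_eq_iff)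
    ultimately show ?thesis unfolding graph_shift_eq by blast
  qed
  show "\<exists>e. biwalk e \<and> agree m x (labels e)" if x: "x \<in> S" for x m
  proof -
    have "factor x (- int m) (2 * m + 1) \<in> language (graph_shift G l)"
      using factor_in_language[OF x] lang by blast
    then have "\<exists>y\<in>graph_shift G l. agree m x y" using tr' by (rule language_closed_agree)
    then show ?thesis unfolding graph_shift_eq by blast
  qed
  show "labels e \<in> S" if "biwalk e" for e
  proof -
    have "labels e \<in> graph_shift G l" using that unfolding graph_shift_eq by blast
    then have "factor (labels e) (- int m) (2 * m + 1) \<in> language S" for m
      using factor_in_language lang by blast
    then have "\<exists>y\<in>S. agree m (labels e) y" for m using tr by (rule language_closed_agree)
    then show ?thesis using S unfolding subshift_iff by blast
  qed
qed

text \<open>Membership in the set of all points with factors in \<open>L\<close> is tested on finite windows, so this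
  set is closed by construction.\<close>

lemma language_subshift_exists:
  "\<exists>S. subshift S \<and> language S = language (graph_shift G l)"
proof -
  define L where "L = language (graph_shift G l)"
  define S where "S = {x. \<forall>i n. factor x i n \<in> L}"
  have fac: "factor (translate k x) i n = factor x (i + k) n" for k x i n
    by (simp add: ac_simps)
  have mem: "translate k x \<in> S" if "x \<in> S" for k x
    using that unfolding S_def by (simp only: fac mem_Collect_eq) blast
  have "x \<in> S" if x: "\<And>m. \<exists>y\<in>S. agree m x y" for x
    unfolding S_def
  proof (intro CollectI allI)
    fix i n
    obtain y where y: "y \<in> S" "agree (nat \<bar>i\<bar> + n) x y" using x by blast
    then have "factor x i n = factor y i n" unfolding factor_eq_iff agree_def by simp
    moreover have "factor y i n \<in> L" using y(1) unfolding S_def by blast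
    ultimately show "factor x i n \<in> L" by (simp only:)
  qed
  moreover have "translate 1 ` S = S"
  proof
    show "translate 1 ` S \<subseteq> S" using mem by blast
    show "S \<subseteq> translate 1 ` S"
    proof
      fix x assume "x \<in> S"
      then show "x \<in> translate 1 ` S" by (intro image_eqI[of _ _ "translate (-1) x"] mem) simp
    qed
  qed
  ultimately have "subshift S" unfolding subshift_iff by blast
  moreover have "language S \<subseteq> L" unfolding language_eq S_def by blast
  moreover have "graph_shift G l \<subseteq> S" unfolding S_def L_def using factor_in_language by blast
  then have "L \<subseteq> language S" unfolding L_def language_eq by blast
  ultimately show ?thesis unfolding L_def by blast
qed

end

theorem mainTheorem4:
  fixes G :: "('v, 'e) pre_digraph" and l :: "'e \<Rightarrow> 'a::finite"
  assumes "fin_digraph G" and "essential G"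
  shows "(\<exists>S. subshift S \<and> chain_mixing S \<and> language S = language (graph_shift G l)) \<longleftrightarrow>
         connected_graph (linking_graph G l) \<and> \<not> periodic_graph (linking_graph G l)"
proof -
  interpret fin_digraph G by (rule assms(1))
  interpret essential_labelled_graph G l by unfold_locales (rule assms(2))
  have "chain_mixing S \<longleftrightarrow>
      connected_graph (linking_graph G l) \<and> \<not> periodic_graph (linking_graph G l)"
    if "subshift S" "language S = language (graph_shift G l)" for S
    using graph_subshift.chain_mixing_iff[OF graph_subshift_of_language[OF that]] .
  then show ?thesis using language_subshift_exists by blast
qed

end
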